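(* Let $(X,T)$ be a topological dynamical system and $\varepsilon>0$. Then: (1) $\mathscr{E}^{*}_{\varepsilon}$ is open and inversely invariant, that is, $T^{-1}\mathscr{E}^{*}_{\varepsilon}\subset\mathscr{E}^{*}_{\varepsilon}$. Moreover, $\mathscr{E}^{*}=\bigcap_{m=1}^{\infty}\mathscr{E}^{*}_{1/m}$ is a $G_\delta$ subset of $X$. (2) If $(X,T)$ is transitive, the set of weakly equicontinuous in the mean points is either empty or residual. If in addition $(X,T)$ is almost weakly equicontinuous in the mean, then every transitive point is weakly equicontinuous in the mean. (3) If $(X,T)$ is minimal and almost weakly equicontinuous in the mean, then it is weakly equicontinuous in the mean.
   Context: A topological dynamical system $(X,T)$ consists of a nonempty compact metric space $X$ with metric $d$ and a continuous map $T:X\to X$. A point is a transitive point if its forward orbit $\{x,Tx,T^2x,\dots\}$ is dense in $X$. $(X,T)$ is transitive if it has a transitive point; here it is understood, as a standing convention, that in a transitive system the set of transitive points is a dense $G_\delta$ subset of $X$. $(X,T)$ is minimal if every point is a transitive point. $S_n$ denotes the group of permutations of $\{1,\dots,n\}$, $B(x,\delta)$ the open ball. A point $x\in X$ is weakly equicontinuous in the mean if for every $\varepsilon>0$ there is $\delta>0$ such that for every $y\in B(x,\delta)$, $\sup_{n\ge1}\inf_{\sigma\in S_n}\frac1n\sum_{i=1}^n d(T^ix,T^{\sigma(i)}y)<\varepsilon$. $\mathscr{E}^{*}$ is the set of all weakly equicontinuous in the mean points, and $$\mathscr{E}^{*}_{\varepsilon}=\Big\{x\in X:\exists\delta>0,\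 \forall y,z\in B(x,\delta),\ \sup_{n\ge1}\inf_{\sigma\in S_n}\frac1n\sum_{i=1}^n d(T^iy,T^{\sigma(i)}z)<\varepsilon\Big\}.$$ $(X,T)$ is weakly equicontinuous in the mean if every point of $X$ is weakly equicontinuous in the mean; it is almost weakly equicontinuous in the mean if it is transitive and has at least one weakly equicontinuous in the mean point. A set is residual if it contains a countable intersection of dense open sets. *)

theory Defs
  imports "HOL-Analysis.Analysis" "HOL-Combinatorics.Permutations"
begin

text \<open>The phase space is a whole type of class \<open>metric_space\<close> (nonempty, like every type) with
  compact universe; \<open>T\<close> is a continuous self-map.\<close>

definition topological_dynamical_system :: "('a::metric_space \<Rightarrow> 'a) \<Rightarrow> bool" where
  "topological_dynamical_system T \<longleftrightarrow> compact (UNIV :: 'a set) \<and> continuous_on UNIV T"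

definition transitive_point :: "('a::metric_space \<Rightarrow> 'a) \<Rightarrow> 'a \<Rightarrow> bool" where
  "transitive_point T x \<longleftrightarrow> closure (range (\<lambda>n. (T ^^ n) x)) = UNIV"

text \<open>The second and third conjuncts are a standing convention on transitive systems. Density does not
  follow from the existence of a transitive point if the space has isolated points: consider
  \<open>n \<mapsto> n + 1\<close> on the one-point compactification of the natural numbers.\<close>

definition transitive_system :: "('a::metric_space \<Rightarrow> 'a) \<Rightarrow> bool" where
  "transitive_system T \<longleftrightarrow>
     (\<exists>x. transitive_point T x) \<and>
     gdelta {x. transitive_point T x} \<and>
     closure {x. transitive_point T x} = UNIV"

definition minimal_system :: "('a::metric_space \<Rightarrow> 'a) \<Rightarrow> bool" where
  "minimal_system T \<longleftrightarrow> (\<forall>x. transitive_point T x)"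

text \<open>The supremum is over reals: on a compact space the averages are bounded by the diameter, and
  each infimum is over a finite nonempty set, so both are the genuine ones.\<close>

definition weak_mean_dist :: "('a::metric_space \<Rightarrow> 'a) \<Rightarrow> 'a \<Rightarrow> 'a \<Rightarrow> real" where
  "weak_mean_dist T x y =
     (SUP n\<in>{1::nat..}. INF \<sigma>\<in>{\<sigma>. \<sigma> permutes {1..n}}.
        1 / real n * (\<Sum>i=1..n. dist ((T ^^ i) x) ((T ^^ (\<sigma> i)) y)))"

definition weakly_equicontinuous_in_mean_point :: "('a::metric_space \<Rightarrow> 'a) \<Rightarrow> 'a \<Rightarrow> bool" where
  "weakly_equicontinuous_in_mean_point T x \<longleftrightarrow>
     (\<forall>\<epsilon>>0. \<exists>\<delta>>0. \<forall>y\<in>ball x \<delta>. weak_mean_dist T x y < \<epsilon>)"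

definition wem_points :: "('a::metric_space \<Rightarrow> 'a) \<Rightarrow> 'a set" where
  "wem_points T = {x. weakly_equicontinuous_in_mean_point T x}"

definition wem_eps_points :: "('a::metric_space \<Rightarrow> 'a) \<Rightarrow> real \<Rightarrow> 'a set" where
  "wem_eps_points T \<epsilon> =
     {x. \<exists>\<delta>>0. \<forall>y\<in>ball x \<delta>. \<forall>z\<in>ball x \<delta>. weak_mean_dist T y z < \<epsilon>}"

definition weakly_equicontinuous_in_mean :: "('a::metric_space \<Rightarrow> 'a) \<Rightarrow> bool" where
  "weakly_equicontinuous_in_mean T \<longleftrightarrow> (\<forall>x. weakly_equicontinuous_in_mean_point T x)"

definition almost_weakly_equicontinuous_in_mean :: "('a::metric_space \<Rightarrow> 'a) \<Rightarrow> bool" where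
  "almost_weakly_equicontinuous_in_mean T \<longleftrightarrow>
     transitive_system T \<and> (\<exists>x. weakly_equicontinuous_in_mean_point T x)"

definition residual :: "'a::topological_space set \<Rightarrow> bool" where
  "residual A \<longleftrightarrow>
     (\<exists>\<U>. countable \<U> \<and> (\<forall>U\<in>\<U>. open U \<and> closure U = UNIV) \<and> \<Inter>\<U> \<subseteq> A)"

end

theory Submission
  imports Defs
begin

text \<open>
  The function \<^term>\<open>weak_mean_dist T\<close> behaves like a pseudometric: matchings of orbit segments can be
  inverted and composed, which gives symmetry and the triangle inequality. Hence nearby points
  that are close to the centre in this distance are also close to each other, and
  \<^term>\<open>wem_points T\<close> is the intersection of the sets \<^term>\<open>wem_eps_points T (1 / real m)\<close>,
  which are visibly open.

  The dynamical input is a single inequality (\<open>weak_mean_dist_le_max_image\<close>): the weak mean distance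
  of two points is at most the maximum of the distance and the weak mean distance of their images,
  because a matching of the orbits of the images extends to the original orbits by pairing their
  first points. By continuity, if \<^term>\<open>T x\<close> lies in \<^term>\<open>wem_eps_points T \<epsilon>\<close>, so does \<^term>\<open>x\<close>.
  A transitive point visits every nonempty open set, so it is pulled back into each
  \<^term>\<open>wem_eps_points T (1 / real m)\<close> as soon as these sets are nonempty, that is, as soon as there is
  one weakly equicontinuous in the mean point. Residuality follows because the transitive points
  are dense, and the minimal case because there every point is transitive.
\<close>

section \<open>The weak mean distance as a pseudometric\<close>

text \<open>The supremum and the infimum disappear from all later arguments through this criterion. The
  infimum is attained, since there are finitely many permutations, and compactness bounds the
  supremum. The trivial case \<open>n = 0\<close> is included to start the shift argument below.\<close>

lemma weak_mean_dist_le_iff: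
  fixes T :: "'a::metric_space \<Rightarrow> 'a"
  assumes "compact (UNIV :: 'a set)"
  shows "weak_mean_dist T x y \<le> c \<longleftrightarrow>
    (\<forall>n. \<exists>\<sigma>. \<sigma> permutes {1..n} \<and>
      (\<Sum>i=1..n. dist ((T ^^ i) x) ((T ^^ (\<sigma> i)) y)) \<le> real n * c)"
    (is "_ \<longleftrightarrow> (\<forall>n. \<exists>\<sigma>. \<sigma> permutes _ \<and> ?S n \<sigma> \<le> _)")
proof -
  define P where "P n = {\<sigma>. \<sigma> permutes {1..n::nat}}" for n
  define F where "F n = (INF \<sigma>\<in>P n. 1 / real n * ?S n \<sigma>)" for n
  have W: "weak_mean_dist T x y = (SUP n\<in>{1..}. F n)"
    by (simp add: weak_mean_dist_def F_def P_def)
  have fin: "finite (P n)" and id: "id \<in> P n" for n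
    by (auto simp: P_def finite_permutations permutes_id)
  have F_le: "F n \<le> 1 / real n * ?S n \<sigma>" if "\<sigma> \<in> P n" for n \<sigma>
    unfolding F_def using fin that by (intro cINF_lower) auto
  have F_attained: "\<exists>\<sigma>\<in>P n. F n = 1 / real n * ?S n \<sigma>" for n
  proof -
    have "F n = Min ((\<lambda>\<sigma>. 1 / real n * ?S n \<sigma>) ` P n)"
      unfolding F_def using fin id by (intro cInf_eq_Min) auto
    moreover have "Min ((\<lambda>\<sigma>. 1 / real n * ?S n \<sigma>) ` P n) \<in> (\<lambda>\<sigma>. 1 / real n * ?S n \<sigma>) ` P n"
      using fin id by (intro Min_in) auto
    ultimately show ?thesis by auto
  qed
  have F_le_iff: "F n \<le> c \<longleftrightarrow> (\<exists>\<sigma>. \<sigma> permutes {1..n} \<and> ?S n \<sigma> \<le> real n * c)" if "n \<ge> 1" for n c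
  proof -
    have eq: "1 / real n * s \<le> c \<longleftrightarrow> s \<le> real n * c" for s
      using that by (simp add: field_simps)
    show ?thesis
    proof
      assume "F n \<le> c"
      then obtain \<sigma> where "\<sigma> \<in> P n" "1 / real n * ?S n \<sigma> \<le> c"
        using F_attained[of n] by auto
      then show "\<exists>\<sigma>. \<sigma> permutes {1..n} \<and> ?S n \<sigma> \<le> real n * c"
        unfolding eq P_def by blast
    next
      assume "\<exists>\<sigma>. \<sigma> permutes {1..n} \<and> ?S n \<sigma> \<le> real n * c"
      then obtain \<sigma> where "\<sigma> \<in> P n" "1 / real n * ?S n \<sigma> \<le> c"
        unfolding eq P_def by blast
      then show "F n \<le> c"
        using F_le[of \<sigma> n] by linarith
    qed
  qed
  obtain D where D: "\<And>u v :: 'a. dist u v \<le> D"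
    using compact_imp_bounded[OF assms] by (auto simp: bounded_two_points)
  have bdd: "bdd_above (F ` {1..})"
  proof (rule bdd_aboveI2)
    fix n :: nat assume "n \<in> {1..}"
    then have "n \<ge> 1" by simp
    have "?S n id \<le> real (card {1..n}) * D"
      by (rule sum_bounded_above) (rule D)
    then have "?S n id \<le> real n * D"
      by (simp only: card_atLeastAtMost diff_Suc_1)
    then show "F n \<le> D"
      using F_le_iff[OF \<open>n \<ge> 1\<close>, of D] permutes_id[of "{1..n}"] by blast
  qed
  have "weak_mean_dist T x y \<le> c \<longleftrightarrow> (\<forall>n\<in>{1..}. F n \<le> c)"
    unfolding W using bdd by (intro cSUP_le_iff) auto
  also have "\<dots> \<longleftrightarrow> (\<forall>n\<ge>1. \<exists>\<sigma>. \<sigma> permutes {1..n} \<and> ?S n \<sigma> \<le> real n * c)"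
    using F_le_iff by auto
  also have "\<dots> \<longleftrightarrow> (\<forall>n. \<exists>\<sigma>. \<sigma> permutes {1..n} \<and> ?S n \<sigma> \<le> real n * c)"
  proof -
    have "(\<forall>n\<ge>1. Q n) \<longleftrightarrow> (\<forall>n. Q n)" if "Q 0" for Q :: "nat \<Rightarrow> bool"
      using that by (metis less_one linorder_not_le)
    then show ?thesis
      by this (auto intro: exI[of _ id] permutes_id)
  qed
  finally show ?thesis .
qed

lemma weak_mean_dist_attained:
  fixes T :: "'a::metric_space \<Rightarrow> 'a"
  assumes "compact (UNIV :: 'a set)"
  obtains \<sigma> where "\<sigma> permutes {1..n}"
    "(\<Sum>i=1..n. dist ((T ^^ i) x) ((T ^^ (\<sigma> i)) y)) \<le> real n * weak_mean_dist T x y"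
  using weak_mean_dist_le_iff[OF assms, of T x y "weak_mean_dist T x y"] by blast

text \<open>The inverse of a matching of \<open>x\<close> with \<open>y\<close> is a matching of \<open>y\<close> with \<open>x\<close> of the same cost.\<close>

lemma weak_mean_dist_commute_le:
  fixes T :: "'a::metric_space \<Rightarrow> 'a"
  assumes c: "compact (UNIV :: 'a set)"
  shows "weak_mean_dist T y x \<le> weak_mean_dist T x y"
  unfolding weak_mean_dist_le_iff[OF c]
proof
  fix n
  obtain \<sigma> where \<sigma>: "\<sigma> permutes {1..n}"
    and le: "(\<Sum>i=1..n. dist ((T ^^ i) x) ((T ^^ (\<sigma> i)) y)) \<le> real n * weak_mean_dist T x y"
    using weak_mean_dist_attained[OF c] .
  have "(\<Sum>i=1..n. dist ((T ^^ i) y) ((T ^^ (inv \<sigma> i)) x)) =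
      (\<Sum>i=1..n. dist ((T ^^ (\<sigma> i)) y) ((T ^^ i) x))"
    by (subst sum.permute[OF \<sigma>]) (simp add: permutes_inverses[OF \<sigma>])
  also have "\<dots> \<le> real n * weak_mean_dist T x y"
    using le by (simp add: dist_commute)
  finally show "\<exists>\<sigma>. \<sigma> permutes {1..n} \<and>
      (\<Sum>i=1..n. dist ((T ^^ i) y) ((T ^^ (\<sigma> i)) x)) \<le> real n * weak_mean_dist T x y"
    using permutes_inv[OF \<sigma>] by blast
qed

lemma weak_mean_dist_commute:
  fixes T :: "'a::metric_space \<Rightarrow> 'a"
  assumes "compact (UNIV :: 'a set)"
  shows "weak_mean_dist T x y = weak_mean_dist T y x"
  using weak_mean_dist_commute_le[OF assms] by (intro antisym)

text \<open>Matchings compose, and the pointwise triangle inequality bounds the cost of the composition.\<close>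

lemma weak_mean_dist_triangle:
  fixes T :: "'a::metric_space \<Rightarrow> 'a"
  assumes c: "compact (UNIV :: 'a set)"
  shows "weak_mean_dist T x z \<le> weak_mean_dist T x y + weak_mean_dist T y z"
  unfolding weak_mean_dist_le_iff[OF c]
proof
  fix n
  obtain \<sigma> where \<sigma>: "\<sigma> permutes {1..n}"
    and xy: "(\<Sum>i=1..n. dist ((T ^^ i) x) ((T ^^ (\<sigma> i)) y)) \<le> real n * weak_mean_dist T x y"
    using weak_mean_dist_attained[OF c] .
  obtain \<tau> where \<tau>: "\<tau> permutes {1..n}"
    and yz: "(\<Sum>i=1..n. dist ((T ^^ i) y) ((T ^^ (\<tau> i)) z)) \<le> real n * weak_mean_dist T y z"
    using weak_mean_dist_attained[OF c] .
  have "(\<Sum>i=1..n. dist ((T ^^ i) x) ((T ^^ ((\<tau> \<circ> \<sigma>) i)) z)) \<le>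
      (\<Sum>i=1..n. dist ((T ^^ i) x) ((T ^^ (\<sigma> i)) y) +
        dist ((T ^^ (\<sigma> i)) y) ((T ^^ (\<tau> (\<sigma> i))) z))"
    by (intro sum_mono) (simp add: dist_triangle)
  also have "\<dots> = (\<Sum>i=1..n. dist ((T ^^ i) x) ((T ^^ (\<sigma> i)) y)) +
      (\<Sum>i=1..n. dist ((T ^^ i) y) ((T ^^ (\<tau> i)) z))"
    by (subst (3) sum.permute[OF \<sigma>]) (simp add: sum.distrib)
  also have "\<dots> \<le> real n * (weak_mean_dist T x y + weak_mean_dist T y z)"
    using xy yz by (simp add: distrib_left)
  finally show "\<exists>\<sigma>. \<sigma> permutes {1..n} \<and>
      (\<Sum>i=1..n. dist ((T ^^ i) x) ((T ^^ (\<sigma> i)) z))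
        \<le> real n * (weak_mean_dist T x y + weak_mean_dist T y z)"
    using permutes_compose[OF \<sigma> \<tau>] by blast
qed

section \<open>Pulling back along the map\<close>

text \<open>This extends a matching of the orbits of the images to the original orbits, whose indices are
  larger by one. It pairs the first points with each other, because \<^term>\<open>\<tau>\<close> fixes \<open>0\<close>.\<close>

lemma permutes_shift_Suc:
  assumes "\<tau> permutes {1..m::nat}"
  shows "(\<lambda>j. case j of 0 \<Rightarrow> 0 | Suc i \<Rightarrow> Suc (\<tau> i)) permutes {1..Suc m}"
  unfolding permutes_def bij_iff[symmetric]
proof (intro conjI allI impI)
  show "bij (\<lambda>j. case j of 0 \<Rightarrow> 0 | Suc i \<Rightarrow> Suc (\<tau> i))"
    by (rule o_bij[where g = "\<lambda>j. case j of 0 \<Rightarrow> 0 | Suc i \<Rightarrow> Suc (inv \<tau> i)"])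
      (auto simp: fun_eq_iff permutes_inverses[OF assms] split: nat.split)
  show "(case j of 0 \<Rightarrow> 0 | Suc i \<Rightarrow> Suc (\<tau> i)) = j" if "j \<notin> {1..Suc m}" for j
    using that permutes_not_in[OF assms] by (cases j) auto
qed

text \<open>The average over the first \<open>m + 1\<close> points of the two orbits is a convex combination of
  \<^term>\<open>dist (T y) (T z)\<close>, from pairing the first points, and an average for the orbits of \<^term>\<open>T y\<close>
  and \<^term>\<open>T z\<close>. Bounding it by the maximum, not by a sum, is what keeps the same \<open>\<epsilon>\<close> in the
  inverse invariance below.\<close>

lemma weak_mean_dist_le_max_image:
  fixes T :: "'a::metric_space \<Rightarrow> 'a"
  assumes c: "compact (UNIV :: 'a set)"
  shows "weak_mean_dist T y z \<le> max (dist (T y) (T z)) (weak_mean_dist T (T y) (T z))"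
    (is "_ \<le> ?M")
  unfolding weak_mean_dist_le_iff[OF c]
proof
  fix n
  show "\<exists>\<sigma>. \<sigma> permutes {1..n} \<and>
      (\<Sum>i=1..n. dist ((T ^^ i) y) ((T ^^ (\<sigma> i)) z)) \<le> real n * ?M"
  proof (cases n)
    case 0
    then show ?thesis by (auto intro: exI[of _ id] permutes_id)
  next
    case (Suc m)
    obtain \<tau> where \<tau>: "\<tau> permutes {1..m}"
      and le: "(\<Sum>i=1..m. dist ((T ^^ i) (T y)) ((T ^^ (\<tau> i)) (T z)))
        \<le> real m * weak_mean_dist T (T y) (T z)"
      using weak_mean_dist_attained[OF c] .
    define \<sigma> where "\<sigma> j = (case j of 0 \<Rightarrow> 0 | Suc i \<Rightarrow> Suc (\<tau> i))" for j
    have \<sigma>: "\<sigma> permutes {1..n}"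
      unfolding \<sigma>_def Suc by (rule permutes_shift_Suc[OF \<tau>])
    have \<sigma>1: "\<sigma> (Suc 0) = Suc 0"
      using permutes_not_in[OF \<tau>, of 0] by (simp add: \<sigma>_def)
    have "(\<Sum>i=1..n. dist ((T ^^ i) y) ((T ^^ (\<sigma> i)) z)) =
        dist (T y) (T z) + (\<Sum>i=1..m. dist ((T ^^ Suc i) y) ((T ^^ (\<sigma> (Suc i))) z))"
      unfolding Suc
      by (simp add: sum.atLeast_Suc_atMost sum.shift_bounds_cl_Suc_ivl \<sigma>1 del: sum.cl_ivl_Suc)
    also have "(\<Sum>i=1..m. dist ((T ^^ Suc i) y) ((T ^^ (\<sigma> (Suc i))) z)) =
        (\<Sum>i=1..m. dist ((T ^^ i) (T y)) ((T ^^ (\<tau> i)) (T z)))"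
      by (simp add: \<sigma>_def funpow_swap1)
    also have "dist (T y) (T z) + \<dots> \<le> ?M + real m * ?M"
    proof (intro add_mono)
      show "(\<Sum>i=1..m. dist ((T ^^ i) (T y)) ((T ^^ (\<tau> i)) (T z))) \<le> real m * ?M"
        by (rule order_trans[OF le]) (intro mult_left_mono, auto)
    qed simp
    also have "\<dots> = real n * ?M"
      by (simp add: Suc algebra_simps)
    finally show ?thesis
      using \<sigma> by blast
  qed
qed

lemma open_wem_eps_points: "open (wem_eps_points T \<epsilon>)"
  unfolding open_contains_ball
proof
  fix x assume "x \<in> wem_eps_points T \<epsilon>"
  then obtain \<delta> where \<delta>: "\<delta> > 0"
    "\<And>y z. y \<in> ball x \<delta> \<Longrightarrow> z \<in> ball x \<delta> \<Longrightarrow> weak_mean_dist T y z < \<epsilon>"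
    unfolding wem_eps_points_def by blast
  have "u \<in> wem_eps_points T \<epsilon>" if "u \<in> ball x \<delta>" for u
  proof -
    obtain \<eta> where "\<eta> > 0" "ball u \<eta> \<subseteq> ball x \<delta>"
      using openE[OF open_ball \<open>u \<in> ball x \<delta>\<close>] .
    then show ?thesis
      unfolding wem_eps_points_def using \<delta>(2) by blast
  qed
  then show "\<exists>e>0. ball x e \<subseteq> wem_eps_points T \<epsilon>"
    using \<delta>(1) by blast
qed

lemma wem_eps_points_inversely_invariant:
  fixes T :: "'a::metric_space \<Rightarrow> 'a"
  assumes c: "compact (UNIV :: 'a set)" and T: "continuous_on UNIV T" and "\<epsilon> > 0"
    and "T x \<in> wem_eps_points T \<epsilon>"
  shows "x \<in> wem_eps_points T \<epsilon>"
proof -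
  obtain \<delta> where \<delta>: "\<delta> > 0"
    "\<And>y z. y \<in> ball (T x) \<delta> \<Longrightarrow> z \<in> ball (T x) \<delta> \<Longrightarrow> weak_mean_dist T y z < \<epsilon>"
    using assms(4) unfolding wem_eps_points_def by blast
  obtain \<eta> where \<eta>: "\<eta> > 0" "\<And>y. dist y x < \<eta> \<Longrightarrow> dist (T y) (T x) < min \<delta> (\<epsilon> / 2)"
    using T \<delta>(1) \<open>\<epsilon> > 0\<close> unfolding continuous_on_iff
    by (metis UNIV_I half_gt_zero min_less_iff_conj)
  have "weak_mean_dist T y z < \<epsilon>" if "y \<in> ball x \<eta>" "z \<in> ball x \<eta>" for y z
  proof -
    have near: "dist (T y) (T x) < min \<delta> (\<epsilon> / 2)" "dist (T z) (T x) < min \<delta> (\<epsilon> / 2)"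
      using \<eta>(2)[of y] \<eta>(2)[of z] that unfolding mem_ball dist_commute[of x] by blast+
    have "dist (T y) (T z) < \<epsilon>"
      using near dist_triangle2[of "T y" "T z" "T x"] by linarith
    moreover have "weak_mean_dist T (T y) (T z) < \<epsilon>"
      using near by (intro \<delta>(2)) (auto simp: dist_commute)
    ultimately show ?thesis
      using weak_mean_dist_le_max_image[OF c, of T y z] by linarith
  qed
  then show ?thesis
    unfolding wem_eps_points_def using \<eta>(1) by blast
qed

section \<open>Equicontinuity points and transitive points\<close>

text \<open>Comparing two nearby points with the centre and adding costs a factor of two; it is absorbed
  because all \<open>m\<close> are considered at once.\<close>

lemma wem_points_eq_INT:
  fixes T :: "'a::metric_space \<Rightarrow> 'a"
  assumes c: "compact (UNIV :: 'a set)"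
  shows "wem_points T = (\<Inter>m\<in>{1::nat..}. wem_eps_points T (1 / real m))"
proof (intro set_eqI iffI)
  fix x assume x: "x \<in> wem_points T"
  show "x \<in> (\<Inter>m\<in>{1::nat..}. wem_eps_points T (1 / real m))"
  proof
    fix m :: nat assume "m \<in> {1..}"
    then have "1 / real m / 2 > 0" by simp
    then obtain \<delta> where \<delta>: "\<delta> > 0" "\<And>y. y \<in> ball x \<delta> \<Longrightarrow> weak_mean_dist T x y < 1 / real m / 2"
      using x unfolding wem_points_def weakly_equicontinuous_in_mean_point_def by blast
    have "weak_mean_dist T y z < 1 / real m" if "y \<in> ball x \<delta>" "z \<in> ball x \<delta>" for y z
      using \<delta>(2)[OF that(1)] \<delta>(2)[OF that(2)] weak_mean_dist_triangle[OF c, of T y z x]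
        weak_mean_dist_commute[OF c, of T y x] by simp
    then show "x \<in> wem_eps_points T (1 / real m)"
      unfolding wem_eps_points_def using \<delta>(1) by blast
  qed
next
  fix x assume x: "x \<in> (\<Inter>m\<in>{1::nat..}. wem_eps_points T (1 / real m))"
  have "\<exists>\<delta>>0. \<forall>y\<in>ball x \<delta>. weak_mean_dist T x y < \<epsilon>" if pos: "\<epsilon> > 0" for \<epsilon>
  proof -
    obtain k where k: "1 / real (Suc k) < \<epsilon>"
      using nat_approx_posE[OF pos] .
    have "x \<in> wem_eps_points T (1 / real (Suc k))"
      using x by (rule INT_D) simp
    then obtain \<delta> where "\<delta> > 0" "\<forall>y\<in>ball x \<delta>. weak_mean_dist T x y < 1 / real (Suc k)"
      unfolding wem_eps_points_def using centre_in_ball by blast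
    then show ?thesis
      using k by (meson less_trans)
  qed
  then show "x \<in> wem_points T"
    unfolding wem_points_def weakly_equicontinuous_in_mean_point_def by blast
qed

lemma transitive_point_visits_open:
  assumes "transitive_point T x" "open U" "U \<noteq> {}"
  obtains n where "(T ^^ n) x \<in> U"
proof -
  have "U \<inter> range (\<lambda>n. (T ^^ n) x) \<noteq> {}"
    using assms open_Int_closure_eq_empty[of U "range (\<lambda>n. (T ^^ n) x)"]
    unfolding transitive_point_def by simp
  then show ?thesis
    using that by blast
qed

text \<open>The orbit of a transitive point enters the open set \<^term>\<open>wem_eps_points T \<epsilon>\<close>, and inverse
  invariance carries membership back along the orbit to its starting point.\<close>

lemma transitive_point_in_wem_eps_points:
  fixes T :: "'a::metric_space \<Rightarrow> 'a"
  assumes c: "compact (UNIV :: 'a set)" and T: "continuous_on UNIV T" and "\<epsilon> > 0"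
    and "wem_eps_points T \<epsilon> \<noteq> {}" and "transitive_point T x"
  shows "x \<in> wem_eps_points T \<epsilon>"
proof -
  obtain n where "(T ^^ n) x \<in> wem_eps_points T \<epsilon>"
    using transitive_point_visits_open[OF assms(5) open_wem_eps_points assms(4)] by blast
  then show ?thesis
    using wem_eps_points_inversely_invariant[OF c T \<open>\<epsilon> > 0\<close>] by (induction n) auto
qed

theorem proposition4p4:
  fixes T :: "'a::metric_space \<Rightarrow> 'a" and \<epsilon> :: real
  assumes "topological_dynamical_system T" and "\<epsilon> > 0"
  shows
    "(open (wem_eps_points T \<epsilon>) \<and>
      T -` wem_eps_points T \<epsilon> \<subseteq> wem_eps_points T \<epsilon> \<and>
      wem_points T = (\<Inter>m\<in>{1::nat..}. wem_eps_points T (1 / real m)) \<and>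
      gdelta (wem_points T)) \<and>
     (transitive_system T \<longrightarrow>
      (wem_points T = {} \<or> residual (wem_points T)) \<and>
      (almost_weakly_equicontinuous_in_mean T \<longrightarrow>
        (\<forall>x. transitive_point T x \<longrightarrow> weakly_equicontinuous_in_mean_point T x))) \<and>
     (minimal_system T \<and> almost_weakly_equicontinuous_in_mean T \<longrightarrow>
      weakly_equicontinuous_in_mean T)"
proof -
  have c: "compact (UNIV :: 'a set)" and T: "continuous_on UNIV T"
    using assms(1) by (auto simp: topological_dynamical_system_def)
  let ?E = "\<lambda>m::nat. wem_eps_points T (1 / real m)"
  have Int: "wem_points T = (\<Inter>m\<in>{1..}. ?E m)"
    by (rule wem_points_eq_INT[OF c])
  have transitive_in: "x \<in> ?E m" if "wem_points T \<noteq> {}" "m \<ge> 1" "transitive_point T x" for m x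
    using that Int by (intro transitive_point_in_wem_eps_points[OF c T]) auto
  have transitive_wem: "weakly_equicontinuous_in_mean_point T x"
    if "almost_weakly_equicontinuous_in_mean T" "transitive_point T x" for x
  proof -
    have "wem_points T \<noteq> {}"
      using that(1) by (auto simp: almost_weakly_equicontinuous_in_mean_def wem_points_def)
    then have "x \<in> wem_points T"
      unfolding Int using transitive_in that(2) \<open>wem_points T \<noteq> {}\<close> by auto
    then show ?thesis by (simp add: wem_points_def)
  qed
  have "gdelta (wem_points T)"
  proof -
    have "{1..} = range Suc"
      by (simp add: atLeast_Suc_greaterThan greaterThan_0)
    then have "wem_points T = (\<Inter>n. ?E (Suc n))"
      unfolding Int by (simp only: image_image)
    then show ?thesis
      using gdelta.intros[of "\<lambda>n. ?E (Suc n)", OF open_wem_eps_points] by (simp only:)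
  qed
  moreover have "residual (wem_points T)" if "transitive_system T" "wem_points T \<noteq> {}"
  proof -
    have "closure (?E m) = UNIV" if "m \<ge> 1" for m
      using closure_mono[of "{x. transitive_point T x}" "?E m"] transitive_in that
        \<open>transitive_system T\<close> \<open>wem_points T \<noteq> {}\<close>
      unfolding transitive_system_def by auto
    then show ?thesis
      unfolding residual_def Int
      by (intro exI[of _ "?E ` {1..}"]) (auto intro: open_wem_eps_points)
  qed
  moreover have "T -` wem_eps_points T \<epsilon> \<subseteq> wem_eps_points T \<epsilon>"
    by (rule subsetI, rule wem_eps_points_inversely_invariant[OF c T assms(2)], erule vimageD)
  moreover have "weakly_equicontinuous_in_mean T"
    if "minimal_system T" "almost_weakly_equicontinuous_in_mean T"
    using that transitive_wem
    unfolding minimal_system_def weakly_equicontinuous_in_mean_def by blast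
  ultimately show ?thesis
    using transitive_wem by (intro conjI impI open_wem_eps_points Int) blast+
qed

end
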